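(* Let $n$ be an arbitrary positive integer and $\lambda$ be an arbitrary infinite cardinal. Then for any $T_1$-topology $\tau$ on $\exp_n\lambda$ the following conditions are equivalent: (i) $(\exp_n\lambda,\tau)$ is a compact topological semilattice; (ii) $\tau=\tau_{\mathsf{c}}^n$; (iii) $(\exp_n\lambda,\tau)$ is a countably compact topological semilattice; (iv) $(\exp_n\lambda,\tau)$ is a feebly compact topological semilattice; (v) $(\exp_n\lambda,\tau)$ is a compact semitopological semilattice; (vi) $(\exp_n\lambda,\tau)$ is a countably compact semitopological semilattice.
   Context: For a positive integer $n$ and a non-zero cardinal $\lambda$, $\exp_n\lambda=\{A\subseteq\lambda : |A|\leqslant n\}$, regarded as a semilattice (commutative semigroup of idempotents) with operation $\cap$. Its natural partial order ($e\leqslant f$ iff $e\cap f=e$) is inclusion, and ${\uparrow}x=\{y\in\exp_n\lambda : x\subseteq y\}$. A topological (resp. semitopological) semilattice is a topological space together with a continuous (resp. separately continuous) semilattice operation. The topology $\tau_{\mathsf{c}}^n$ on $\exp_n\lambda$ is the one in which each point $x$ has as neighbourhood base the family of all sets $U_x(x_1,\ldots,x_j)={\uparrow}x\setminus({\uparrow}x_1\cup\cdots\cup{\uparrow}x_j)$, where $x_1,\ldots,x_j$ is a finite (possibly empty) list of elements of ${\uparrow}x\setminus\{x\}$. Compact: each open cover has a finite subcover. Countably compact: each countable open cover has a finite subcover. Feebly compact: each locally finite open cover is finite. No separation axiom is included in these notions. *)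

theory Defs
  imports "HOL-Analysis.Analysis"
begin

text \<open>
  The cardinal \<open>\<lambda>\<close> is represented by a set \<open>L\<close> of that cardinality.
  Finiteness is required explicitly because \<^term>\<open>card A = 0\<close> for infinite \<open>A\<close>.
\<close>

definition exp_le :: "nat \<Rightarrow> 'a set \<Rightarrow> 'a set set" where
  "exp_le n L = {A. A \<subseteq> L \<and> finite A \<and> card A \<le> n}"

definition up :: "nat \<Rightarrow> 'a set \<Rightarrow> 'a set \<Rightarrow> 'a set set" where
  "up n L x = {y \<in> exp_le n L. x \<subseteq> y}"

text \<open>\<open>U\<^sub>x(x\<^sub>1, \<dots>, x\<^sub>j)\<close>, with the list given as the set \<open>F = {x\<^sub>1, \<dots>, x\<^sub>j}\<close>.\<close>

definition basic_nbhd :: "nat \<Rightarrow> 'a set \<Rightarrow> 'a set \<Rightarrow> 'a set set \<Rightarrow> 'a set set" where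
  "basic_nbhd n L x F = up n L x - (\<Union>y\<in>F. up n L y)"

definition tau_c :: "nat \<Rightarrow> 'a set \<Rightarrow> 'a set topology" where
  "tau_c n L = topology (\<lambda>U. U \<subseteq> exp_le n L \<and>
     (\<forall>x\<in>U. \<exists>F. finite F \<and> F \<subseteq> up n L x - {x} \<and> basic_nbhd n L x F \<subseteq> U))"

lemma openin_tau_c:
  "openin (tau_c n L) U \<longleftrightarrow> U \<subseteq> exp_le n L \<and>
     (\<forall>x\<in>U. \<exists>F. finite F \<and> F \<subseteq> up n L x - {x} \<and> basic_nbhd n L x F \<subseteq> U)"
proof -
  let ?P = "\<lambda>U. U \<subseteq> exp_le n L \<and>
     (\<forall>x\<in>U. \<exists>F. finite F \<and> F \<subseteq> up n L x - {x} \<and> basic_nbhd n L x F \<subseteq> U)"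
  have "?P (S \<inter> T)" if S: "?P S" and T: "?P T" for S T
  proof (intro conjI ballI)
    show "S \<inter> T \<subseteq> exp_le n L" using S by blast
    fix x assume x: "x \<in> S \<inter> T"
    obtain F where F: "finite F" "F \<subseteq> up n L x - {x}" "basic_nbhd n L x F \<subseteq> S"
      using S x by blast
    obtain G where G: "finite G" "G \<subseteq> up n L x - {x}" "basic_nbhd n L x G \<subseteq> T"
      using T x by blast
    have "basic_nbhd n L x (F \<union> G) \<subseteq> S \<inter> T"
      using F(3) G(3) by (auto simp: basic_nbhd_def)
    then show "\<exists>F. finite F \<and> F \<subseteq> up n L x - {x} \<and> basic_nbhd n L x F \<subseteq> S \<inter> T"
      using F(1,2) G(1,2) by (intro exI[of _ "F \<union> G"]) auto
  qed
  moreover have "?P (\<Union>\<K>)" if K: "\<forall>K\<in>\<K>. ?P K" for \<K>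
  proof (intro conjI ballI)
    show "\<Union>\<K> \<subseteq> exp_le n L" using K by blast
    fix x assume "x \<in> \<Union>\<K>"
    then obtain W where W: "W \<in> \<K>" "x \<in> W" by blast
    have "?P W" using K W(1) by (rule bspec)
    then obtain F where F: "finite F" "F \<subseteq> up n L x - {x}" "basic_nbhd n L x F \<subseteq> W"
      using W(2) by metis
    have "basic_nbhd n L x F \<subseteq> \<Union>\<K>"
      using F(3) W(1) by (meson Union_upper order_trans)
    then show "\<exists>F. finite F \<and> F \<subseteq> up n L x - {x} \<and> basic_nbhd n L x F \<subseteq> \<Union>\<K>"
      using F(1,2) by (intro exI[of _ F] conjI)
  qed
  ultimately have "istopology ?P"
    unfolding istopology_def by (intro conjI allI impI) simp_all
  then show ?thesis
    by (simp add: tau_c_def)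
qed

text \<open>
  With \<open>openin_tau_c\<close>: the sets \<^const>\<open>basic_nbhd\<close> form a neighbourhood base at each point.
\<close>

lemma openin_basic_nbhd:
  assumes "x \<in> exp_le n L" "finite F" "F \<subseteq> up n L x - {x}"
  shows "openin (tau_c n L) (basic_nbhd n L x F)" and "x \<in> basic_nbhd n L x F"
proof -
  show "x \<in> basic_nbhd n L x F"
    using assms by (auto simp: basic_nbhd_def up_def)
  have "\<exists>G. finite G \<and> G \<subseteq> up n L y - {y} \<and> basic_nbhd n L y G \<subseteq> basic_nbhd n L x F"
    if y: "y \<in> basic_nbhd n L x F" for y
  proof (intro exI conjI)
    let ?G = "((\<union>) y ` F) \<inter> exp_le n L"
    show "finite ?G" using assms(2) by blast
    show "?G \<subseteq> up n L y - {y}"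
      using y by (auto simp: basic_nbhd_def up_def)
    show "basic_nbhd n L y ?G \<subseteq> basic_nbhd n L x F"
    proof
      fix z assume z: "z \<in> basic_nbhd n L y ?G"
      have zE: "z \<in> exp_le n L" and yz: "y \<subseteq> z" and xy: "x \<subseteq> y"
        using z y by (auto simp: basic_nbhd_def up_def)
      have "\<not> f \<subseteq> z" if f: "f \<in> F" for f
      proof
        assume "f \<subseteq> z"
        then have sub: "y \<union> f \<subseteq> z" using yz by blast
        have "finite z" "card z \<le> n" "z \<subseteq> L"
          using zE by (auto simp: exp_le_def)
        then have "y \<union> f \<in> exp_le n L"
          using sub card_mono[of z "y \<union> f"] finite_subset[of "y \<union> f" z]
          by (auto simp: exp_le_def)
        then have "y \<union> f \<in> ?G" using f by blast
        then show False
          using z sub zE unfolding basic_nbhd_def up_def by blast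
      qed
      then show "z \<in> basic_nbhd n L x F"
        using zE yz xy by (auto simp: basic_nbhd_def up_def)
    qed
  qed
  moreover have "basic_nbhd n L x F \<subseteq> exp_le n L"
    by (auto simp: basic_nbhd_def up_def)
  ultimately show "openin (tau_c n L) (basic_nbhd n L x F)"
    unfolding openin_tau_c by blast
qed

lemma topspace_tau_c: "topspace (tau_c n L) = exp_le n L"
proof
  show "topspace (tau_c n L) \<subseteq> exp_le n L"
    using openin_tau_c openin_topspace by blast
  have "openin (tau_c n L) (exp_le n L)"
    unfolding openin_tau_c
  proof (intro conjI ballI)
    show "\<exists>F. finite F \<and> F \<subseteq> up n L x - {x} \<and> basic_nbhd n L x F \<subseteq> exp_le n L" for x
      by (rule exI[of _ "{}"]) (auto simp: basic_nbhd_def up_def)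
  qed simp
  then show "exp_le n L \<subseteq> topspace (tau_c n L)"
    by (rule openin_subset)
qed

definition semilattice_on :: "'b set \<Rightarrow> ('b \<Rightarrow> 'b \<Rightarrow> 'b) \<Rightarrow> bool" where
  "semilattice_on S m \<longleftrightarrow>
     (\<forall>x\<in>S. \<forall>y\<in>S. m x y \<in> S) \<and>
     (\<forall>x\<in>S. \<forall>y\<in>S. \<forall>z\<in>S. m (m x y) z = m x (m y z)) \<and>
     (\<forall>x\<in>S. \<forall>y\<in>S. m x y = m y x) \<and>
     (\<forall>x\<in>S. m x x = x)"

definition topological_semilattice :: "'b topology \<Rightarrow> ('b \<Rightarrow> 'b \<Rightarrow> 'b) \<Rightarrow> bool" where
  "topological_semilattice X m \<longleftrightarrow>
     semilattice_on (topspace X) m \<and>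
     continuous_map (prod_topology X X) X (\<lambda>(x, y). m x y)"

definition semitopological_semilattice :: "'b topology \<Rightarrow> ('b \<Rightarrow> 'b \<Rightarrow> 'b) \<Rightarrow> bool" where
  "semitopological_semilattice X m \<longleftrightarrow>
     semilattice_on (topspace X) m \<and>
     (\<forall>a\<in>topspace X. continuous_map X X (\<lambda>x. m a x) \<and> continuous_map X X (\<lambda>x. m x a))"

definition countably_compact_space :: "'b topology \<Rightarrow> bool" where
  "countably_compact_space X \<longleftrightarrow>
     (\<forall>\<U>. countable \<U> \<and> (\<forall>U\<in>\<U>. openin X U) \<and> \<Union>\<U> = topspace X \<longrightarrow>
        (\<exists>\<F>. finite \<F> \<and> \<F> \<subseteq> \<U> \<and> \<Union>\<F> = topspace X))"

definition feebly_compact_space :: "'b topology \<Rightarrow> bool" where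
  "feebly_compact_space X \<longleftrightarrow>
     (\<forall>\<U>. (\<forall>U\<in>\<U>. openin X U) \<and> \<Union>\<U> = topspace X \<and> locally_finite_in X \<U> \<longrightarrow> finite \<U>)"

end

theory Submission
  imports Defs
begin

text \<open>
  Write \<open>\<tau>\<^sub>c\<close> for \<^term>\<open>tau_c n L\<close>. Two facts drive the equivalences.

  First, \<open>\<tau>\<^sub>c\<close> has all the good properties: it is compact by downward induction on cardinality
  (\<open>compact_tau_c\<close>), and intersection is jointly continuous in it
  (\<open>topological_semilattice_tau_c\<close>).

  Second, \<open>\<tau>\<^sub>c\<close> is the coarsest \<open>T\<^sub>1\<close> topology making intersection separately continuous.
  The cone \<open>\<up>x\<close> is the fibre over \<open>x\<close> of the map \<open>y \<mapsto> x \<inter> y\<close>, which takes only finitely many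
  values, so in such a topology it is clopen (\<open>clopen_up\<close>). Hence it remains to exclude topologies
  that are strictly finer.

  Suppose that an open set \<open>N\<close> around \<open>x\<close> contains no \<open>\<tau>\<^sub>c\<close>-neighbourhood of \<open>x\<close>. Points outside
  \<open>N\<close> can then be chosen above \<open>x\<close>, one after the other, each meeting the earlier ones only in \<open>x\<close>
  (\<open>infinite_sunflower\<close>). Such a family of points is locally finite: away from \<open>x\<close> because the
  cones are clopen, and at \<open>x\<close> because of \<open>N\<close> (\<open>locally_finite_sunflower\<close>). An infinite locally
  finite set of points contradicts countable compactness.

  It contradicts feeble compactness if its points are isolated, and points with exactly \<open>n\<close>
  elements are. This is where joint continuity enters: with \<open>W\<close> around \<open>x\<close> such that
  \<open>s \<inter> t \<in> U\<close> for \<open>s, t \<in> W\<close>, the argument applied to \<open>W\<close> and to \<open>n\<close>-element sets alone shows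
  that \<open>W\<close> contains all \<open>n\<close>-element sets of some \<open>\<tau>\<^sub>c\<close>-neighbourhood of \<open>x\<close>. Every member of that
  neighbourhood is the intersection of two of them, since \<open>L\<close> is infinite, and so lies in \<open>U\<close>
  (\<open>eq_tau_c_if_feebly_compact\<close>).
\<close>

text \<open>
  For finite \<open>A\<close> disjoint from \<open>x\<close> these sets form another neighbourhood base of \<open>\<tau>\<^sub>c\<close> at \<open>x\<close>,
  which excludes finitely many elements of \<open>L\<close> instead of finitely many cones. No case
  distinction is needed when adding an element of \<open>A\<close> to \<open>x\<close> exceeds the size bound.
\<close>

definition cone_avoiding :: "nat \<Rightarrow> 'a set \<Rightarrow> 'a set \<Rightarrow> 'a set \<Rightarrow> 'a set set" where
  "cone_avoiding n L x A = {y \<in> exp_le n L. x \<subseteq> y \<and> y \<inter> A = {}}"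

section \<open>The topology \<open>\<tau>\<^sub>c\<close>\<close>

lemma exp_le_mono: "x \<subseteq> y \<Longrightarrow> y \<in> exp_le n L \<Longrightarrow> x \<in> exp_le n L"
  unfolding exp_le_def by (auto intro: finite_subset order_trans[OF card_mono])

lemma semilattice_on_exp_le: "semilattice_on (exp_le n L) (\<inter>)"
  unfolding semilattice_on_def by (auto intro: exp_le_mono[OF Int_lower1])

lemma openin_tau_c_cone:
  assumes "x \<in> exp_le n L" "finite A" "A \<inter> x = {}"
  shows "openin (tau_c n L) (cone_avoiding n L x A)"
proof -
  (* The intersection matters when x already has n elements. *)
  let ?F = "((\<lambda>a. insert a x) ` A) \<inter> exp_le n L"
  have "insert a x \<in> exp_le n L" if "y \<in> exp_le n L" "x \<subseteq> y" "a \<in> y" for a y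
    using that exp_le_mono[of "insert a x" y] by simp
  then have "cone_avoiding n L x A = basic_nbhd n L x ?F"
    unfolding cone_avoiding_def basic_nbhd_def up_def by blast
  moreover have "?F \<subseteq> up n L x - {x}"
    using assms(3) by (auto simp: up_def)
  ultimately show ?thesis
    using openin_basic_nbhd(1)[OF assms(1), of ?F] assms(2) by simp
qed

text \<open>
  Excluding single elements is enough: if \<open>a\<close> lies in \<open>f\<close> but not in \<open>x\<close>, then avoiding \<open>a\<close>
  keeps a set out of the cone over \<open>f\<close>.
\<close>

lemma openin_tau_c_iff_cone:
  "openin (tau_c n L) U \<longleftrightarrow> U \<subseteq> exp_le n L \<and>
     (\<forall>x\<in>U. \<exists>A. finite A \<and> A \<inter> x = {} \<and> cone_avoiding n L x A \<subseteq> U)" (is "_ = ?rhs")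
proof
  assume U: "openin (tau_c n L) U"
  have "\<exists>A. finite A \<and> A \<inter> x = {} \<and> cone_avoiding n L x A \<subseteq> U" if x: "x \<in> U" for x
  proof -
    obtain F where F: "finite F" "F \<subseteq> up n L x - {x}" "basic_nbhd n L x F \<subseteq> U"
      using U x unfolding openin_tau_c by meson
    have "\<forall>f\<in>F. \<exists>a. a \<in> f \<and> a \<notin> x"
      using F(2) by (auto simp: up_def)
    then obtain p where p: "\<And>f. f \<in> F \<Longrightarrow> p f \<in> f \<and> p f \<notin> x"
      by metis
    have "cone_avoiding n L x (p ` F) \<subseteq> basic_nbhd n L x F"
      using p unfolding cone_avoiding_def basic_nbhd_def up_def by blast
    then show ?thesis
      using F(1,3) p by (intro exI[of _ "p ` F"]) auto
  qed
  then show ?rhs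
    using U unfolding openin_tau_c by blast
next
  assume R: ?rhs
  have "\<exists>T. openin (tau_c n L) T \<and> x \<in> T \<and> T \<subseteq> U" if x: "x \<in> U" for x
  proof -
    obtain A where A: "finite A" "A \<inter> x = {}" "cone_avoiding n L x A \<subseteq> U"
      using R x by blast
    have xE: "x \<in> exp_le n L" using R x by blast
    then have "x \<in> cone_avoiding n L x A"
      using A(2) by (auto simp: cone_avoiding_def)
    then show ?thesis
      using openin_tau_c_cone[OF xE A(1,2)] A(3) by blast
  qed
  then show "openin (tau_c n L) U"
    using openin_subopen by blast
qed

text \<open>
  A member of the cover containing \<open>y\<close> covers the cone over \<open>y\<close> except for finitely many cones
  over strictly larger sets, and cardinalities are bounded by \<open>n\<close>. The cone over the empty set is
  the whole space.
\<close>

lemma compact_tau_c: "compact_space (tau_c n L)"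
  unfolding compact_space_alt topspace_tau_c
proof (intro allI impI, elim conjE)
  fix \<U> assume op: "\<forall>U\<in>\<U>. openin (tau_c n L) U" and cov: "exp_le n L \<subseteq> \<Union>\<U>"
  have "\<exists>\<F>. finite \<F> \<and> \<F> \<subseteq> \<U> \<and> up n L y \<subseteq> \<Union>\<F>" if "y \<in> exp_le n L" for y
    using that
  proof (induction "n - card y" arbitrary: y rule: less_induct)
    case less
    obtain U where U: "U \<in> \<U>" "y \<in> U" using cov less.prems by blast
    then obtain F where F: "finite F" "F \<subseteq> up n L y - {y}" "basic_nbhd n L y F \<subseteq> U"
      using op unfolding openin_tau_c by meson
    have "\<exists>\<F>. finite \<F> \<and> \<F> \<subseteq> \<U> \<and> up n L f \<subseteq> \<Union>\<F>" if f: "f \<in> F" for f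
    proof (rule less.hyps)
      have "y \<subset> f" and fE: "f \<in> exp_le n L" using F(2) f by (auto simp: up_def)
      then have "card y < card f" "card f \<le> n"
        by (auto simp: exp_le_def psubset_card_mono)
      then show "n - card f < n - card y" by simp
      show "f \<in> exp_le n L" by (fact fE)
    qed
    then obtain G where G: "\<And>f. f \<in> F \<Longrightarrow> finite (G f) \<and> G f \<subseteq> \<U> \<and> up n L f \<subseteq> \<Union>(G f)"
      by metis
    have "up n L y \<subseteq> \<Union>(insert U (\<Union>f\<in>F. G f))"
    proof
      fix z assume z: "z \<in> up n L y"
      show "z \<in> \<Union>(insert U (\<Union>f\<in>F. G f))"
      proof (cases "\<exists>f\<in>F. z \<in> up n L f")
        case True
        then obtain f where "f \<in> F" "z \<in> up n L f" by blast
        then show ?thesis using G[of f] by auto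
      next
        case False
        then have "z \<in> U" using z F(3) by (auto simp: basic_nbhd_def)
        then show ?thesis by simp
      qed
    qed
    moreover have "finite (insert U (\<Union>f\<in>F. G f))" "insert U (\<Union>f\<in>F. G f) \<subseteq> \<U>"
      using F(1) G U(1) by auto
    ultimately show ?case by blast
  qed
  moreover have "{} \<in> exp_le n L" by (simp add: exp_le_def)
  moreover have "up n L {} = exp_le n L" by (auto simp: up_def)
  ultimately show "\<exists>\<F>. finite \<F> \<and> \<F> \<subseteq> \<U> \<and> exp_le n L \<subseteq> \<Union>\<F>" by metis
qed

lemma topological_semilattice_tau_c: "topological_semilattice (tau_c n L) (\<inter>)"
  unfolding topological_semilattice_def
proof
  show "semilattice_on (topspace (tau_c n L)) (\<inter>)"
    by (simp add: topspace_tau_c semilattice_on_exp_le)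
  let ?E = "exp_le n L"
  show "continuous_map (prod_topology (tau_c n L) (tau_c n L)) (tau_c n L) (\<lambda>(x, y). x \<inter> y)"
    unfolding continuous_map_def
  proof (intro conjI allI impI)
    show "(\<lambda>(x, y). x \<inter> y) \<in> topspace (prod_topology (tau_c n L) (tau_c n L)) \<rightarrow> topspace (tau_c n L)"
      by (auto simp: topspace_tau_c intro: exp_le_mono[OF Int_lower1])
    fix U assume U: "openin (tau_c n L) U"
    have "\<exists>V W. openin (tau_c n L) V \<and> openin (tau_c n L) W \<and> x \<in> V \<and> y \<in> W \<and>
        V \<times> W \<subseteq> {p \<in> ?E \<times> ?E. (case p of (x, y) \<Rightarrow> x \<inter> y) \<in> U}"
      if xE: "x \<in> ?E" and yE: "y \<in> ?E" and xy: "x \<inter> y \<in> U" for x y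
    proof -
      obtain A where A: "finite A" "A \<inter> (x \<inter> y) = {}" "cone_avoiding n L (x \<inter> y) A \<subseteq> U"
        using U xy unfolding openin_tau_c_iff_cone by blast
      let ?V = "cone_avoiding n L x (A - x)" and ?W = "cone_avoiding n L y (A - y)"
      have "s \<inter> t \<in> U" if s: "s \<in> ?V" and t: "t \<in> ?W" for s t
      proof -
        (* A point of A in both s and t would have to lie in both x and y. *)
        have "s \<inter> t \<inter> A = {}" "x \<inter> y \<subseteq> s \<inter> t"
          using s t A(2) by (auto simp: cone_avoiding_def)
        moreover have "s \<inter> t \<in> ?E"
          using s by (auto simp: cone_avoiding_def intro: exp_le_mono[OF Int_lower1])
        ultimately show ?thesis using A(3) by (auto simp: cone_avoiding_def)
      qed
      moreover have "?V \<subseteq> ?E" "?W \<subseteq> ?E" by (auto simp: cone_avoiding_def)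
      ultimately have "?V \<times> ?W \<subseteq> {p \<in> ?E \<times> ?E. (case p of (x, y) \<Rightarrow> x \<inter> y) \<in> U}"
        by auto
      moreover have "openin (tau_c n L) ?V" "openin (tau_c n L) ?W"
        using xE yE A(1) by (auto intro!: openin_tau_c_cone)
      moreover have "x \<in> ?V" "y \<in> ?W" using xE yE by (auto simp: cone_avoiding_def)
      ultimately show ?thesis by blast
    qed
    then show "openin (prod_topology (tau_c n L) (tau_c n L))
        {p \<in> topspace (prod_topology (tau_c n L) (tau_c n L)). (case p of (x, y) \<Rightarrow> x \<inter> y) \<in> U}"
      unfolding openin_prod_topology_alt topspace_prod_topology topspace_tau_c by auto
  qed
qed

section \<open>Weakenings of compactness and of joint continuity\<close>

lemma topological_imp_semitopological_semilattice:
  assumes "topological_semilattice X m"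
  shows "semitopological_semilattice X m"
proof -
  have m: "continuous_map (prod_topology X X) X (\<lambda>(x, y). m x y)"
    using assms by (simp add: topological_semilattice_def)
  have "continuous_map X X (\<lambda>x. m a x)" "continuous_map X X (\<lambda>x. m x a)"
    if a: "a \<in> topspace X" for a
  proof -
    have "continuous_map X (prod_topology X X) (\<lambda>x. (a, x))"
      "continuous_map X (prod_topology X X) (\<lambda>x. (x, a))"
      using a by (auto intro!: continuous_map_pairedI)
    from this[THEN continuous_map_compose, OF m]
    show "continuous_map X X (\<lambda>x. m a x)" "continuous_map X X (\<lambda>x. m x a)"
      by (simp_all add: o_def)
  qed
  then show ?thesis
    using assms by (simp add: topological_semilattice_def semitopological_semilattice_def)
qed

lemma compact_imp_countably_compact_space:
  assumes "compact_space X"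
  shows "countably_compact_space X"
  unfolding countably_compact_space_def
proof (intro allI impI, elim conjE)
  fix \<U> assume op: "\<forall>U\<in>\<U>. openin X U" and cov: "\<Union>\<U> = topspace X"
  then obtain \<F> where F: "finite \<F>" "\<F> \<subseteq> \<U>" "topspace X \<subseteq> \<Union>\<F>"
    using assms unfolding compact_space_alt by (metis order_refl)
  moreover have "\<Union>\<F> \<subseteq> topspace X" using F(2) cov by blast
  ultimately show "\<exists>\<F>. finite \<F> \<and> \<F> \<subseteq> \<U> \<and> \<Union>\<F> = topspace X" by blast
qed

lemma compact_imp_feebly_compact_space:
  assumes "compact_space X"
  shows "feebly_compact_space X"
  unfolding feebly_compact_space_def
proof (intro allI impI, elim conjE)
  fix \<U> assume cov: "\<Union>\<U> = topspace X" and lf: "locally_finite_in X \<U>"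
  let ?\<V> = "{V. openin X V \<and> finite {U \<in> \<U>. U \<inter> V \<noteq> {}}}"
  have "topspace X \<subseteq> \<Union>?\<V>"
    using lf unfolding locally_finite_in_def by blast
  then obtain \<F> where F: "finite \<F>" "\<F> \<subseteq> ?\<V>" "topspace X \<subseteq> \<Union>\<F>"
    using assms unfolding compact_space_alt by (metis (no_types, lifting) mem_Collect_eq)
  have "\<U> \<subseteq> insert {} (\<Union>V\<in>\<F>. {U \<in> \<U>. U \<inter> V \<noteq> {}})"
    using F(3) cov by blast
  moreover have "finite (insert {} (\<Union>V\<in>\<F>. {U \<in> \<U>. U \<inter> V \<noteq> {}}))"
    using F(1,2) by auto
  ultimately show "finite \<U>" by (rule finite_subset)
qed

section \<open>Infinite locally finite sets of points\<close>

text \<open>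
  In a \<open>T\<^sub>1\<close> space local finiteness makes every subset of \<open>D\<close> closed. Indexing the cover by
  the finite subsets \<open>E\<close> of \<open>D\<close>, the points of \<open>D\<close> that are kept, makes it countable and
  directed.
\<close>

lemma not_countably_compact_if_locally_finite_points:
  assumes "t1_space X" "infinite D" "countable D" and lf: "locally_finite_in X ((\<lambda>d. {d}) ` D)"
  shows "\<not> countably_compact_space X"
proof
  assume cc: "countably_compact_space X"
  have sub: "D \<subseteq> topspace X"
    using lf by (auto simp: locally_finite_in_def)
  have op: "openin X (topspace X - (D - E))" for E
  proof -
    have "closedin X (\<Union>((\<lambda>d. {d}) ` (D - E)))"
    proof (rule closedin_locally_finite_Union)
      show "closedin X S" if "S \<in> (\<lambda>d. {d}) ` (D - E)" for S
        using that assms(1) sub by (auto simp: t1_space_closedin_singleton)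
      show "locally_finite_in X ((\<lambda>d. {d}) ` (D - E))"
        using lf by (rule locally_finite_in_subset) auto
    qed
    then show ?thesis by (simp add: openin_diff)
  qed
  let ?\<U> = "(\<lambda>E. topspace X - (D - E)) ` {E. finite E \<and> E \<subseteq> D}"
  have "countable ?\<U>"
    using assms(3) by (simp add: countable_Collect_finite_subset)
  moreover have "\<Union>?\<U> = topspace X"
  proof
    show "topspace X \<subseteq> \<Union>?\<U>"
    proof
      fix z assume "z \<in> topspace X"
      then have "z \<in> topspace X - (D - ({z} \<inter> D))" by blast
      moreover have "{z} \<inter> D \<in> {E. finite E \<and> E \<subseteq> D}" by simp
      ultimately show "z \<in> \<Union>?\<U>" by blast
    qed
  qed auto
  moreover have "\<forall>U\<in>?\<U>. openin X U" using op by blast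
  ultimately obtain \<F> where F: "finite \<F>" "\<F> \<subseteq> ?\<U>" "\<Union>\<F> = topspace X"
    using cc unfolding countably_compact_space_def by meson
  obtain \<E> where E: "\<E> \<subseteq> {E. finite E \<and> E \<subseteq> D}" "finite \<E>" "\<F> = (\<lambda>E. topspace X - (D - E)) ` \<E>"
    using finite_subset_image[OF F(1,2)] by blast
  have "finite (\<Union>\<E>)" using E(1,2) by blast
  then obtain d where "d \<in> D" "d \<notin> \<Union>\<E>"
    using assms(2) by (meson finite_subset subsetI)
  then show False
    using F(3) E(3) sub by blast
qed

text \<open>
  The singletons become a cover, without losing local finiteness, by adding the whole space.
\<close>

lemma not_feebly_compact_if_locally_finite_isolated_points:
  assumes "infinite D" and lf: "locally_finite_in X ((\<lambda>d. {d}) ` D)"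
    and "\<And>d. d \<in> D \<Longrightarrow> openin X {d}"
  shows "\<not> feebly_compact_space X"
proof
  assume fc: "feebly_compact_space X"
  let ?\<U> = "insert (topspace X) ((\<lambda>d. {d}) ` D)"
  have opens: "\<forall>U\<in>?\<U>. openin X U" using assms(3) by auto
  have cover: "\<Union>?\<U> = topspace X"
    using lf by (auto simp: locally_finite_in_def)
  have "locally_finite_in X ?\<U>"
    unfolding locally_finite_in_def
  proof (intro conjI ballI)
    fix z assume "z \<in> topspace X"
    then obtain V where V: "openin X V" "z \<in> V" "finite {U \<in> (\<lambda>d. {d}) ` D. U \<inter> V \<noteq> {}}"
      using lf unfolding locally_finite_in_def by blast
    have "{U \<in> ?\<U>. U \<inter> V \<noteq> {}} \<subseteq> insert (topspace X) {U \<in> (\<lambda>d. {d}) ` D. U \<inter> V \<noteq> {}}"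
      by blast
    then have "finite {U \<in> ?\<U>. U \<inter> V \<noteq> {}}"
      using V(3) by (meson finite.insertI finite_subset)
    then show "\<exists>V. openin X V \<and> z \<in> V \<and> finite {U \<in> ?\<U>. U \<inter> V \<noteq> {}}"
      using V(1,2) by blast
  qed (simp only: cover order_refl)
  then have "finite ?\<U>"
    using fc[unfolded feebly_compact_space_def, rule_format, of ?\<U>] opens cover by simp
  then have "finite ((\<lambda>d. {d}) ` D)" by simp
  then have "finite D" by (rule finite_imageD) (simp add: inj_on_def)
  then show False using assms(1) by simp
qed

section \<open>Topologies in which intersection is separately continuous\<close>

text \<open>
  The cone over \<open>x\<close> consists of the \<open>y\<close> with \<open>x \<inter> y = x\<close>. It is closed because \<open>x\<close> is a closed
  point. It is also open: \<open>x \<inter> y\<close> ranges over the finite set of subsets of \<open>x\<close>, so being equal to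
  \<open>x\<close> means avoiding the finite, hence closed, set of the others.
\<close>

lemma clopen_up:
  assumes top: "topspace X = exp_le n L" and t1: "t1_space X"
    and semi: "semitopological_semilattice X (\<inter>)" and x: "x \<in> exp_le n L"
  shows "openin X (up n L x)" "closedin X (up n L x)"
proof -
  have cont: "continuous_map X X (\<lambda>y. x \<inter> y)"
    using semi x top by (simp add: semitopological_semilattice_def)
  have "up n L x = {y \<in> topspace X. x \<inter> y \<in> {x}}"
    using top by (auto simp: up_def)
  moreover have "closedin X {x}"
    using t1 x top by (simp add: t1_space_closedin_singleton)
  ultimately show "closedin X (up n L x)"
    using closedin_continuous_map_preimage[OF cont] by presburger
  have "finite (Pow x - {x})"
    using x by (simp add: exp_le_def)
  moreover have "Pow x - {x} \<subseteq> topspace X"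
    using exp_le_mono[OF _ x] top by blast
  ultimately have "openin X (topspace X - (Pow x - {x}))"
    using t1 by (auto simp: t1_space_closedin_finite)
  moreover have "up n L x = {y \<in> topspace X. x \<inter> y \<in> topspace X - (Pow x - {x})}"
    using x top by (auto simp: up_def intro: exp_le_mono[OF Int_lower1])
  ultimately show "openin X (up n L x)"
    using openin_continuous_map_preimage[OF cont] by presburger
qed

lemma openin_if_openin_tau_c:
  assumes "topspace X = exp_le n L" "t1_space X" "semitopological_semilattice X (\<inter>)"
    and U: "openin (tau_c n L) U"
  shows "openin X U"
proof (subst openin_subopen, intro ballI)
  fix x assume x: "x \<in> U"
  obtain F where F: "finite F" "F \<subseteq> up n L x - {x}" "basic_nbhd n L x F \<subseteq> U"
    using U x unfolding openin_tau_c by meson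
  have xE: "x \<in> exp_le n L" using U x unfolding openin_tau_c by blast
  have "closedin X (\<Union>f\<in>F. up n L f)"
    using F(1,2) clopen_up(2)[OF assms(1-3)] by (intro closedin_Union) (auto simp: up_def)
  then have "openin X (basic_nbhd n L x F)"
    unfolding basic_nbhd_def using clopen_up(1)[OF assms(1-3) xE] by (rule openin_diff[rotated])
  moreover have "x \<in> basic_nbhd n L x F"
    using openin_basic_nbhd(2)[OF xE F(1,2)] .
  ultimately show "\<exists>T. openin X T \<and> x \<in> T \<and> T \<subseteq> U" using F(3) by blast
qed

text \<open>
  Greedy choice: the next set avoids the finitely many elements outside \<open>x\<close> used so far.
  As \<open>x\<close> itself is not available, no set is chosen twice.
\<close>

lemma infinite_sunflower:
  assumes "x \<notin> S" and fin: "\<And>y. y \<in> S \<Longrightarrow> finite y"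
    and ex: "\<And>A. finite A \<Longrightarrow> A \<inter> x = {} \<Longrightarrow> \<exists>y\<in>S. x \<subseteq> y \<and> y \<inter> A = {}"
  obtains D where "D \<subseteq> S" "infinite D" "countable D" "\<And>d. d \<in> D \<Longrightarrow> x \<subseteq> d"
    "\<And>d e. d \<in> D \<Longrightarrow> e \<in> D \<Longrightarrow> d \<noteq> e \<Longrightarrow> d \<inter> e = x"
proof -
  have "\<exists>f::nat \<Rightarrow> 'a set. \<forall>k. f k \<in> S \<and> x \<subseteq> f k \<and> (\<forall>j<k. f k \<inter> f j = x)"
  proof (rule dependent_wellorder_choice)
    fix k :: nat and f :: "nat \<Rightarrow> 'a set"
    assume IH: "\<And>j. j < k \<Longrightarrow> f j \<in> S \<and> x \<subseteq> f j \<and> (\<forall>i<j. f j \<inter> f i = x)"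
    obtain y where "y \<in> S" "x \<subseteq> y" "y \<inter> (\<Union>j<k. f j - x) = {}"
      using ex[of "\<Union>j<k. f j - x"] fin IH by auto
    then show "\<exists>y. y \<in> S \<and> x \<subseteq> y \<and> (\<forall>j<k. y \<inter> f j = x)"
      using IH by (intro exI[of _ y]) blast
  qed auto
  then obtain f :: "nat \<Rightarrow> 'a set"
    where f: "\<And>k. f k \<in> S" "\<And>k. x \<subseteq> f k" "\<And>j k. j < k \<Longrightarrow> f k \<inter> f j = x"
    by blast
  have meet: "f i \<inter> f j = x" if "i \<noteq> j" for i j
    using that f(3)[of i j] f(3)[of j i] by (cases "i < j") auto
  have "inj f"
  proof (rule injI, rule ccontr)
    fix i j assume "f i = f j" "i \<noteq> j"
    then have "f i = x" using meet[of i j] by simp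
    then show False using f(1)[of i] assms(1) by simp
  qed
  then have inf: "infinite (range f)" using range_inj_infinite by blast
  show thesis
  proof (rule that)
    show "range f \<subseteq> S" using f(1) by blast
    show "infinite (range f)" by (fact inf)
    show "x \<subseteq> d" if "d \<in> range f" for d using that f(2) by blast
    show "d \<inter> e = x" if "d \<in> range f" "e \<in> range f" "d \<noteq> e" for d e
      using that meet by (metis imageE)
  qed simp
qed

text \<open>
  The only point where a sunflower with kernel \<open>x\<close> can accumulate is \<open>x\<close>: a point not above \<open>x\<close>
  is separated from it by the complement of the cone over \<open>x\<close>, and the cone over a point strictly
  above \<open>x\<close> contains at most one petal. The set \<open>N\<close> rules out accumulation at \<open>x\<close>.
\<close>

lemma locally_finite_sunflower:
  assumes top: "topspace X = exp_le n L" and t1: "t1_space X"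
    and semi: "semitopological_semilattice X (\<inter>)"
    and N: "openin X N" "x \<in> N"
    and D: "D \<subseteq> exp_le n L - N" "\<And>d. d \<in> D \<Longrightarrow> x \<subseteq> d"
    "\<And>d e. d \<in> D \<Longrightarrow> e \<in> D \<Longrightarrow> d \<noteq> e \<Longrightarrow> d \<inter> e = x"
  shows "locally_finite_in X ((\<lambda>d. {d}) ` D)"
  unfolding locally_finite_in_def
proof (intro conjI ballI)
  show "\<Union>((\<lambda>d. {d}) ` D) \<subseteq> topspace X" using D(1) top by blast
  fix z assume "z \<in> topspace X"
  then have zE: "z \<in> exp_le n L" using top by simp
  have xE: "x \<in> exp_le n L" using N top openin_subset by blast
  note up = clopen_up[OF top t1 semi]
  have "\<exists>V. openin X V \<and> z \<in> V \<and> finite (V \<inter> D)"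
  proof (cases "x \<subseteq> z")
    case False
    have "openin X (topspace X - up n L x)" using up(2)[OF xE] by blast
    moreover have "(topspace X - up n L x) \<inter> D = {}" using D(1,2) by (auto simp: up_def)
    ultimately show ?thesis
      using False zE top by (intro exI[of _ "topspace X - up n L x"]) (auto simp: up_def)
  next
    case sub: True
    show ?thesis
    proof (cases "z = x")
      case True
      moreover have "N \<inter> D = {}" using D(1) by blast
      ultimately show ?thesis using N by (intro exI[of _ N]) simp
    next
      case False
      (* Two members of D above z would have an intersection larger than x. *)
      have "d = e" if "d \<in> up n L z \<inter> D" "e \<in> up n L z \<inter> D" for d e
        using that D(3)[of d e] sub False by (auto simp: up_def)
      then have "up n L z \<inter> D = {} \<or> (\<exists>d. up n L z \<inter> D = {d})" by blast
      then have "finite (up n L z \<inter> D)" by auto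
      moreover have "z \<in> up n L z" using zE by (simp add: up_def)
      ultimately show ?thesis using up(1)[OF zE] by blast
    qed
  qed
  then obtain V where V: "openin X V" "z \<in> V" "finite (V \<inter> D)" by blast
  have "{U \<in> (\<lambda>d. {d}) ` D. U \<inter> V \<noteq> {}} = (\<lambda>d. {d}) ` (V \<inter> D)" by auto
  then show "\<exists>V. openin X V \<and> z \<in> V \<and> finite {U \<in> (\<lambda>d. {d}) ` D. U \<inter> V \<noteq> {}}"
    using V by (metis (no_types, lifting) finite_imageI)
qed

text \<open>
  The set \<open>S\<close> is left open because countable compactness allows arbitrary points to be used,
  whereas feeble compactness requires isolated ones.
\<close>

lemma infinite_locally_finite_points_outside:
  assumes "topspace X = exp_le n L" "t1_space X" "semitopological_semilattice X (\<inter>)"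
    and N: "openin X N" "x \<in> N" and S: "S \<subseteq> exp_le n L"
    and ex: "\<And>A. finite A \<Longrightarrow> A \<inter> x = {} \<Longrightarrow> \<not> cone_avoiding n L x A \<inter> S \<subseteq> N"
  obtains D where "D \<subseteq> S" "infinite D" "countable D" "locally_finite_in X ((\<lambda>d. {d}) ` D)"
proof -
  have "\<exists>y\<in>S - N. x \<subseteq> y \<and> y \<inter> A = {}" if "finite A" "A \<inter> x = {}" for A
    using ex[OF that] by (auto simp: cone_avoiding_def)
  moreover have "finite y" if "y \<in> S - N" for y using that S by (auto simp: exp_le_def)
  moreover have "x \<notin> S - N" using N by blast
  ultimately obtain D where D: "D \<subseteq> S - N" "infinite D" "countable D" "\<And>d. d \<in> D \<Longrightarrow> x \<subseteq> d"
    "\<And>d e. d \<in> D \<Longrightarrow> e \<in> D \<Longrightarrow> d \<noteq> e \<Longrightarrow> d \<inter> e = x"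
    using infinite_sunflower[of x "S - N"] by metis
  have "D \<subseteq> exp_le n L - N" using D(1) S by blast
  from locally_finite_sunflower[OF assms(1-3) N this D(4,5)] show thesis
    using D(1-3) that by blast
qed

lemma eq_tau_c_if_cones_fit:
  assumes "topspace X = exp_le n L" "t1_space X" "semitopological_semilattice X (\<inter>)"
    and "\<And>U x. openin X U \<Longrightarrow> x \<in> U \<Longrightarrow>
      \<exists>A. finite A \<and> A \<inter> x = {} \<and> cone_avoiding n L x A \<subseteq> U"
  shows "X = tau_c n L"
  unfolding topology_eq
proof (intro allI iffI)
  fix U assume U: "openin X U"
  then have "U \<subseteq> exp_le n L" using assms(1) openin_subset by blast
  then show "openin (tau_c n L) U"
    using assms(4)[OF U] unfolding openin_tau_c_iff_cone by blast
qed (rule openin_if_openin_tau_c[OF assms(1-3)])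

lemma eq_tau_c_if_countably_compact:
  assumes X: "topspace X = exp_le n L" "t1_space X" "semitopological_semilattice X (\<inter>)"
    and cc: "countably_compact_space X"
  shows "X = tau_c n L"
proof (rule eq_tau_c_if_cones_fit[OF X], rule ccontr)
  fix U x assume U: "openin X U" "x \<in> U"
    and "\<nexists>A. finite A \<and> A \<inter> x = {} \<and> cone_avoiding n L x A \<subseteq> U"
  then have "\<not> cone_avoiding n L x A \<inter> exp_le n L \<subseteq> U" if "finite A" "A \<inter> x = {}" for A
    using that by (auto simp: cone_avoiding_def)
  from infinite_locally_finite_points_outside[OF X U order_refl this]
  obtain D where "infinite D" "countable D" "locally_finite_in X ((\<lambda>d. {d}) ` D)"
    by metis
  then show False
    using not_countably_compact_if_locally_finite_points X(2) cc by blast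
qed

lemma extend_to_card:
  assumes "infinite L" "y \<in> exp_le n L" "finite A" "A \<inter> y = {}"
  obtains t where "t \<in> exp_le n L" "card t = n" "y \<subseteq> t" "t \<inter> A = {}"
proof -
  have y: "y \<subseteq> L" "finite y" "card y \<le> n" using assms(2) by (auto simp: exp_le_def)
  have "infinite (L - (A \<union> y))" using assms(1,3) y(2) by simp
  then obtain B where B: "B \<subseteq> L - (A \<union> y)" "finite B" "card B = n - card y"
    using infinite_arbitrarily_large[of "L - (A \<union> y)" "n - card y"] by metis
  have "card (y \<union> B) = n"
  proof -
    have "y \<inter> B = {}" using B(1) by blast
    then show ?thesis using card_Un_disjoint[of y B] y B(2,3) by simp
  qed
  moreover from this have "y \<union> B \<in> exp_le n L"
    using y(1,2) B(1,2) by (simp add: exp_le_def) blast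
  moreover have "(y \<union> B) \<inter> A = {}" using B(1) assms(4) by blast
  ultimately show thesis using that[of "y \<union> B"] by simp
qed

text \<open>
  Joint continuity at \<open>(x, x)\<close> reduces a neighbourhood \<open>U\<close> of \<open>x\<close> to one, \<open>W\<close>, that only has to
  be controlled on the isolated points \<open>S\<close>, since these generate everything else by intersections.
\<close>

lemma eq_tau_c_if_feebly_compact:
  assumes "infinite L" and top: "topspace X = exp_le n L" and t1: "t1_space X"
    and ts: "topological_semilattice X (\<inter>)" and fc: "feebly_compact_space X"
  shows "X = tau_c n L"
proof -
  note X = top t1 topological_imp_semitopological_semilattice[OF ts]
  define S where "S = {t \<in> exp_le n L. card t = n}"
  have isolated: "openin X {t}" if "t \<in> S" for t
  proof -
    have "y = t" if "y \<in> up n L t" for y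
      using that \<open>t \<in> S\<close> card_seteq[of y t] by (auto simp: up_def S_def exp_le_def)
    then have "up n L t = {t}" using \<open>t \<in> S\<close> by (auto simp: up_def S_def)
    then show ?thesis
      using clopen_up(1)[OF X, of t] that by (simp add: S_def)
  qed
  show ?thesis
  proof (rule eq_tau_c_if_cones_fit[OF X])
    fix U x assume U: "openin X U" "x \<in> U"
    then have xE: "x \<in> exp_le n L" using top openin_subset by blast
    let ?P = "{p \<in> topspace (prod_topology X X). (case p of (y, z) \<Rightarrow> y \<inter> z) \<in> U}"
    have "openin (prod_topology X X) ?P"
      using ts U(1) unfolding topological_semilattice_def continuous_map_def by blast
    moreover have "(x, x) \<in> ?P" using U xE top by simp
    ultimately obtain V V' where V: "openin X V" "openin X V'" "x \<in> V" "x \<in> V'" "V \<times> V' \<subseteq> ?P"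
      unfolding openin_prod_topology_alt by meson
    define W where "W = V \<inter> V'"
    have W: "openin X W" "x \<in> W" using V by (auto simp: W_def)
    have WU: "s \<inter> t \<in> U" if "s \<in> W" "t \<in> W" for s t
      using that V(5) by (auto simp: W_def)
    have "\<exists>A. finite A \<and> A \<inter> x = {} \<and> cone_avoiding n L x A \<inter> S \<subseteq> W"
    proof (rule ccontr)
      assume "\<nexists>A. finite A \<and> A \<inter> x = {} \<and> cone_avoiding n L x A \<inter> S \<subseteq> W"
      then have "\<And>A. finite A \<Longrightarrow> A \<inter> x = {} \<Longrightarrow> \<not> cone_avoiding n L x A \<inter> S \<subseteq> W" by blast
      from infinite_locally_finite_points_outside[OF X W _ this]
      obtain D where "D \<subseteq> S" "infinite D" "locally_finite_in X ((\<lambda>d. {d}) ` D)"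
        by (metis (no_types, lifting) S_def mem_Collect_eq subsetI)
      then show False
        using not_feebly_compact_if_locally_finite_isolated_points isolated fc by blast
    qed
    then obtain A where A: "finite A" "A \<inter> x = {}" "cone_avoiding n L x A \<inter> S \<subseteq> W" by blast
    have "y \<in> U" if y: "y \<in> cone_avoiding n L x A" for y
    proof -
      have yE: "y \<in> exp_le n L" and yA: "A \<inter> y = {}" and xy: "x \<subseteq> y"
        using y by (auto simp: cone_avoiding_def)
      obtain s where s: "s \<in> exp_le n L" "card s = n" "y \<subseteq> s" "s \<inter> A = {}"
        using extend_to_card[OF assms(1) yE A(1) yA] .
      (* Choosing t also disjoint from s - y forces s and t to meet exactly in y. *)
      have "finite (A \<union> (s - y))" "(A \<union> (s - y)) \<inter> y = {}"
        using A(1) s(1) yA by (auto simp: exp_le_def)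
      from extend_to_card[OF assms(1) yE this]
      obtain t where t: "t \<in> exp_le n L" "card t = n" "y \<subseteq> t" "t \<inter> (A \<union> (s - y)) = {}" .
      have "s \<in> W" "t \<in> W"
        using A(3) s t xy by (auto simp: cone_avoiding_def S_def subset_iff)
      then have "s \<inter> t \<in> U" by (rule WU)
      moreover have "s \<inter> t = y" using s(3) t(3,4) by blast
      ultimately show ?thesis by simp
    qed
    then show "\<exists>A. finite A \<and> A \<inter> x = {} \<and> cone_avoiding n L x A \<subseteq> U" using A(1,2) by blast
  qed
qed

section \<open>The equivalences\<close>

theorem theorem1:
  fixes n :: nat and L :: "'a set" and \<tau> :: "'a set topology"
  assumes "n > 0"
    and "infinite L"
    and "topspace \<tau> = exp_le n L"
    and "t1_space \<tau>"
  shows "(compact_space \<tau> \<and> topological_semilattice \<tau> (\<inter>) \<longleftrightarrow> \<tau> = tau_c n L) \<and>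
    (\<tau> = tau_c n L \<longleftrightarrow> countably_compact_space \<tau> \<and> topological_semilattice \<tau> (\<inter>)) \<and>
    (\<tau> = tau_c n L \<longleftrightarrow> feebly_compact_space \<tau> \<and> topological_semilattice \<tau> (\<inter>)) \<and>
    (\<tau> = tau_c n L \<longleftrightarrow> compact_space \<tau> \<and> semitopological_semilattice \<tau> (\<inter>)) \<and>
    (\<tau> = tau_c n L \<longleftrightarrow> countably_compact_space \<tau> \<and> semitopological_semilattice \<tau> (\<inter>))"
proof -
  have "compact_space \<tau> \<and> topological_semilattice \<tau> (\<inter>)" if "\<tau> = tau_c n L"
    using that compact_tau_c topological_semilattice_tau_c by blast
  moreover have "\<tau> = tau_c n L"
    if "countably_compact_space \<tau>" "semitopological_semilattice \<tau> (\<inter>)"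
    using eq_tau_c_if_countably_compact[OF assms(3,4)] that by blast
  moreover have "\<tau> = tau_c n L"
    if "feebly_compact_space \<tau>" "topological_semilattice \<tau> (\<inter>)"
    using eq_tau_c_if_feebly_compact[OF assms(2-4)] that by blast
  (* Compactness and joint continuity are the strongest properties on either side, so the two
     converse implications cover all five conditions. *)
  moreover note compact_imp_countably_compact_space[of \<tau>] compact_imp_feebly_compact_space[of \<tau>]
    topological_imp_semitopological_semilattice[of \<tau> "(\<inter>)"]
  ultimately show ?thesis by blast
qed

end
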